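(* Let $n$ be a non-negative integer, let $0\le\alpha<1$, and let $\beta$ be a real number with $\beta\ge e(1-\alpha)$ if $n=0$, and $\beta\ge e^{n-1}(1-\alpha)$ if $n\ne0$. If $p\in\mathcal{H}_1$ satisfies $$1+\beta\frac{zp'(z)}{p^n(z)}\prec 1+(1-\alpha)z,$$ then $p(z)\prec e^z$.
   Context: $\mathbb{D}=\{z\in\mathbb{C}:|z|<1\}$. $\mathcal{H}_1$ is the class of analytic functions on $\mathbb{D}$ of the form $p(z)=1+a_1z+a_2z^2+\cdots$. $p^n(z)$ means $(p(z))^n$. For functions $F,G$ analytic in $\mathbb{D}$, $F\prec G$ (F is subordinate to G) means there is an analytic $w:\mathbb{D}\to\mathbb{C}$ with $w(0)=0$, $|w(z)|<1$ and $F(z)=G(w(z))$ for all $z\in\mathbb{D}$; writing $F\prec G$ presupposes that $F$ and $G$ are analytic in $\mathbb{D}$. *)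

theory Defs
  imports "HOL-Complex_Analysis.Complex_Analysis"
begin

abbreviation unit_disc :: "complex set" where
  "unit_disc \<equiv> ball 0 1"

definition class_H1 :: "(complex \<Rightarrow> complex) set" where
  "class_H1 = {p. p holomorphic_on unit_disc \<and>
     (\<exists>a. a 0 = 1 \<and> (\<forall>z\<in>unit_disc. (\<lambda>k. a k * z ^ k) sums p z))}"

(* Functions are total, so only their values on the disc matter.  Holomorphy of both sides
   is part of the relation.  In particular, for F z = 1 + b * (z * deriv p z / p z ^ n) with
   p 0 = 1, b \<noteq> 0 and n \<ge> 1, it excludes zeros of p in the disc: F has a pole there, whatever
   value division by zero assigns at the point itself. *)
definition subordinate :: "(complex \<Rightarrow> complex) \<Rightarrow> (complex \<Rightarrow> complex) \<Rightarrow> bool"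
    (infix "\<prec>\<^sub>D" 50) where
  "F \<prec>\<^sub>D G \<longleftrightarrow> F holomorphic_on unit_disc \<and> G holomorphic_on unit_disc \<and>
     (\<exists>w. w holomorphic_on unit_disc \<and> w 0 = 0 \<and>
        (\<forall>z\<in>unit_disc. norm (w z) < 1 \<and> F z = G (w z)))"

end

theory Submission
  imports Defs
begin

text \<open>
  By Schwarz' lemma the hypothesis says \<open>p' = h * p ^ n\<close> with \<open>h\<close> holomorphic on the disc
  and \<open>\<bar>h\<bar> \<le> c = (1 - \<alpha>) / \<beta>\<close>. Let \<open>g\<close> be the primitive of \<open>h\<close> with \<open>g 0 = 0\<close>, so that
  \<open>\<bar>g z\<bar> \<le> c * \<bar>z\<bar>\<close>. The equation can be integrated: \<open>p = 1 + g\<close> if \<open>n = 0\<close>, \<open>p = exp g\<close> if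
  \<open>n = 1\<close>, and \<open>p = exp q\<close> with \<open>exp (- m * q) = 1 - m * g\<close> if \<open>n = m + 1\<close> with \<open>m > 0\<close>.
  It remains to bound the logarithm by \<open>\<bar>ln (1 + u)\<bar> \<le> - ln (1 - \<bar>u\<bar>)\<close>, and \<open>1 + m \<le> exp m\<close>
  is exactly what makes \<open>c \<le> exp (- m)\<close> sufficient for \<open>\<bar>q\<bar> < 1\<close>.
\<close>

text \<open>The norms of the terms in the series of \<open>Ln (1 + u)\<close> are exactly the terms
  in the series of \<open>- ln (1 - norm u)\<close>, so the triangle inequality for series suffices.
  The terms at index 0 vanish because division by zero gives 0.\<close>

lemma norm_Ln_one_plus_le:
  fixes u :: complex
  assumes "norm u < 1"
  shows "norm (Ln (1 + u)) \<le> - ln (1 - norm u)"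
proof -
  have u: "(\<lambda>n. - ((-u) ^ n) / of_nat n) sums ln (1 + u)"
    using assms by (rule Ln_series')
  have "(\<lambda>n. - ((- (- norm u)) ^ n) / of_nat n) sums ln (1 + (- norm u))"
    using assms by (intro ln_series') auto
  from sums_minus[OF this]
  have v: "(\<lambda>n. norm u ^ n / of_nat n) sums (- ln (1 - norm u))"
    by simp
  have "(\<lambda>n. norm (- ((-u) ^ n) / of_nat n)) sums (- ln (1 - norm u))"
    using v by (simp add: norm_divide norm_power)
  then show ?thesis
    using summable_norm[of "\<lambda>n. - ((-u) ^ n) / of_nat n"] u by (simp add: sums_iff)
qed

text \<open>The radius \<open>1 - exp (- t)\<close> is the solution \<open>r\<close> of
  \<open>- ln (1 - r) = t\<close>. It is used with \<open>t = 1\<close> for \<open>n = 0\<close> and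
  with \<open>t = m\<close> for \<open>n = m + 1\<close>, \<open>m > 0\<close>.\<close>

lemma norm_Ln_one_plus_less:
  fixes u :: complex
  assumes "norm u < 1 - exp (- t)"
  shows "norm (Ln (1 + u)) < t"
proof -
  have "norm u < 1"
    using assms exp_gt_zero[of "- t"] by linarith
  moreover have "- t < ln (1 - norm u)"
    using assms \<open>norm u < 1\<close> by (subst ln_exp[symmetric], subst ln_less_cancel_iff) auto
  ultimately show ?thesis
    using norm_Ln_one_plus_le[of u] by linarith
qed

lemma one_plus_notin_nonpos_Reals:
  fixes u :: complex
  assumes "norm u < 1"
  shows "1 + u \<notin> \<real>\<^sub>\<le>\<^sub>0"
proof -
  have "\<bar>Re u\<bar> < 1"
    using assms abs_Re_le_cmod[of u] by linarith
  then show ?thesis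
    by (auto simp: complex_nonpos_Reals_iff)
qed

lemma DERIV_imp_holomorphic_on:
  assumes "\<And>z. z \<in> S \<Longrightarrow> (f has_field_derivative f' z) (at z)"
  shows "f holomorphic_on S"
  using assms by (meson field_differentiable_at_within field_differentiable_def holomorphic_onI)

lemma DERIV_zero_unit_disc:
  assumes "\<And>z. z \<in> unit_disc \<Longrightarrow> (f has_field_derivative 0) (at z)" and "z \<in> unit_disc"
  shows "f z = f 0"
proof -
  have "\<exists>c. \<forall>x\<in>unit_disc. f x = c"
    using assms(1) by (intro has_field_derivative_zero_constant) (auto intro: has_field_derivative_at_within)
  then show ?thesis
    using assms(2) by auto
qed

lemma holomorphic_primitive_unit_disc:
  assumes "h holomorphic_on unit_disc"
  obtains g where "g 0 = 0" "\<And>z. z \<in> unit_disc \<Longrightarrow> (g has_field_derivative h z) (at z)"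
proof -
  obtain g where g: "\<And>z. z \<in> unit_disc \<Longrightarrow> (g has_field_derivative h z) (at z within unit_disc)"
    using holomorphic_convex_primitive'[OF _ _ assms] by auto
  have "((\<lambda>z. g z - g 0) has_field_derivative h z) (at z)" if "z \<in> unit_disc" for z
    using g[OF that] that by (auto simp: at_within_open[of _ unit_disc] intro!: derivative_eq_intros)
  with that[of "\<lambda>z. g z - g 0"] show thesis
    by simp
qed

text \<open>
  Division by zero makes the differential equation available only off the zeros of \<open>p\<close>;
  the identity theorem extends its division-free form to the whole disc.
\<close>
lemma subordinate_imp_ode:
  fixes n :: nat and \<alpha> \<beta> :: real and p :: "complex \<Rightarrow> complex"
  assumes "\<alpha> < 1" and "\<beta> > 0" and holp: "p holomorphic_on unit_disc" and "p 0 = 1"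
    and "(\<lambda>z. 1 + of_real \<beta> * (z * deriv p z / p z ^ n)) \<prec>\<^sub>D (\<lambda>z. 1 + of_real (1 - \<alpha>) * z)"
  obtains h where "h holomorphic_on unit_disc"
    "\<And>z. z \<in> unit_disc \<Longrightarrow> norm (h z) \<le> (1 - \<alpha>) / \<beta>"
    "\<And>z. z \<in> unit_disc \<Longrightarrow> (p has_field_derivative h z * p z ^ n) (at z)"
proof -
  obtain w where w: "w holomorphic_on unit_disc" "w 0 = 0"
    and bound: "\<And>z. z \<in> unit_disc \<Longrightarrow> norm (w z) < 1"
    and eq: "\<And>z. z \<in> unit_disc \<Longrightarrow>
      1 + of_real \<beta> * (z * deriv p z / p z ^ n) = 1 + of_real (1 - \<alpha>) * w z"
    using assms(5) unfolding subordinate_def by blast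
  \<comment> \<open>The factor \<open>z\<close> split off from \<open>w\<close> will cancel against
    the one in \<open>z * deriv p z\<close>.\<close>
  obtain v where v: "v holomorphic_on unit_disc" "\<And>z. norm z < 1 \<Longrightarrow> w z = z * v z"
    and v0: "deriv w 0 = v 0"
    using Schwarz3[OF w] by blast
  have v_le: "norm (v z) \<le> 1" if "z \<in> unit_disc" for z
  proof (cases "z = 0")
    \<comment> \<open>Here \<open>v 0 = deriv w 0\<close>, so the derivative bound of Schwarz' lemma
      applies.\<close>
    case True
    then show ?thesis
      using Schwarz_Lemma(2)[OF w, of 0] bound v0 by simp
  next
    case False
    have "norm (z * v z) \<le> norm z * 1"
      using Schwarz_Lemma(1)[OF w, of z] bound v(2)[of z] that by simp
    then show ?thesis
      using False by (simp add: norm_mult)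
  qed
  define c :: complex where "c = of_real ((1 - \<alpha>) / \<beta>)"
  \<comment> \<open>On \<open>U\<close> the equation can be multiplied by \<open>p z ^ n\<close> and
    divided by \<open>z\<close>.\<close>
  define U where "U = {z \<in> unit_disc. p z * z \<noteq> 0}"
  have contp: "continuous_on unit_disc (\<lambda>z. p z * z)"
    using holp by (intro continuous_intros holomorphic_on_imp_continuous_on)
  have "open (unit_disc \<inter> (\<lambda>z. p z * z) -` (- {0}))"
    by (rule continuous_open_preimage[OF contp]) auto
  moreover have "U = unit_disc \<inter> (\<lambda>z. p z * z) -` (- {0})"
    by (auto simp: U_def)
  ultimately have openU: "open U"
    by simp
  have "open (unit_disc \<inter> p -` (- {0}))"
    using holp by (intro continuous_open_preimage holomorphic_on_imp_continuous_on) auto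
  moreover have "0 \<in> unit_disc \<inter> p -` (- {0})"
    using \<open>p 0 = 1\<close> by simp
  \<comment> \<open>An open set containing 0 has a further point, and that point lies in
    \<open>U\<close>.\<close>
  ultimately have "unit_disc \<inter> p -` (- {0}) \<noteq> {0}"
    by (metis not_open_singleton)
  with \<open>0 \<in> unit_disc \<inter> p -` (- {0})\<close> have "U \<noteq> {}"
    by (fastforce simp: U_def)
  have eqU: "deriv p z = c * v z * p z ^ n" if "z \<in> U" for z
  proof -
    have z: "z \<in> unit_disc" "z \<noteq> 0" "p z \<noteq> 0"
      using that by (auto simp: U_def)
    have "of_real \<beta> * (z * deriv p z / p z ^ n) = of_real (1 - \<alpha>) * (z * v z)"
      using eq[OF z(1)] v(2)[of z] z(1) by simp
    then have "z * (of_real \<beta> * deriv p z) = z * (of_real (1 - \<alpha>) * v z * p z ^ n)"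
      using z by (simp add: field_simps)
    then have "of_real \<beta> * deriv p z = of_real (1 - \<alpha>) * v z * p z ^ n"
      using z(2) by (metis mult_left_cancel)
    then show ?thesis
      using \<open>\<beta> > 0\<close> by (simp add: c_def field_simps)
  qed
  have "deriv p z = c * v z * p z ^ n" if "z \<in> unit_disc" for z
    using openU _ \<open>U \<noteq> {}\<close> _ _ _ _ eqU that
  proof (rule analytic_continuation_open)
    show "U \<subseteq> unit_disc"
      by (auto simp: U_def)
  qed (auto intro!: holomorphic_intros holp v)
  then have "(p has_field_derivative c * v z * p z ^ n) (at z)" if "z \<in> unit_disc" for z
    using holomorphic_derivI[OF holp _ that] that by simp
  moreover have "norm (c * v z) \<le> (1 - \<alpha>) / \<beta>" if "z \<in> unit_disc" for z
  proof -
    have "norm c = (1 - \<alpha>) / \<beta>"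
      unfolding c_def norm_of_real using assms(1,2) by simp
    then show ?thesis
      using mult_left_mono[OF v_le[OF that] norm_ge_zero, of c] by (simp only: norm_mult mult_1_right)
  qed
  moreover have "(\<lambda>z. c * v z) holomorphic_on unit_disc"
    by (intro holomorphic_intros v)
  ultimately show thesis
    using that[of "\<lambda>z. c * v z"] by blast
qed

text \<open>The bounds on \<open>c\<close> are the reciprocals of the factors of
  \<open>1 - \<alpha>\<close> in the lower bounds for \<open>\<beta>\<close>. That \<open>p\<close>
  has no zeros comes out of the integration, in the form \<open>p = exp q\<close>.\<close>

lemma ode_imp_subordinate_exp:
  fixes p h :: "complex \<Rightarrow> complex"
  assumes p': "\<And>z. z \<in> unit_disc \<Longrightarrow> (p has_field_derivative h z * p z ^ n) (at z)"
    and "p 0 = 1" and holh: "h holomorphic_on unit_disc"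
    and h_le: "\<And>z. z \<in> unit_disc \<Longrightarrow> norm (h z) \<le> c"
    and c_le: "c \<le> (if n = 0 then exp (- 1) else exp (- real (n - 1)))"
  shows "p \<prec>\<^sub>D exp"
proof -
  have holp: "p holomorphic_on unit_disc"
    by (rule DERIV_imp_holomorphic_on) (rule p')
  obtain g where "g 0 = 0" and g': "\<And>z. z \<in> unit_disc \<Longrightarrow> (g has_field_derivative h z) (at z)"
    using holomorphic_primitive_unit_disc[OF holh] by blast
  have holg: "g holomorphic_on unit_disc"
    by (rule DERIV_imp_holomorphic_on) (rule g')
  let ?C = "if n = 0 then exp (- 1) else exp (- real (n - 1))"
  have g_less: "norm (g z) < ?C" if "z \<in> unit_disc" for z
  proof -
    have "norm (g z - g 0) \<le> ?C * norm (z - 0)"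
    proof (rule field_differentiable_bound[where S = unit_disc and f' = h])
      show "norm (h x) \<le> ?C" if "x \<in> unit_disc" for x
        using h_le[OF that] c_le by linarith
    qed (use that in \<open>auto intro: has_field_derivative_at_within[OF g']\<close>)
    \<comment> \<open>Strictness comes from \<open>norm z < 1\<close>, so that \<open>c\<close> may
      attain its bound.\<close>
    also have "\<dots> < ?C * 1"
      using that by (intro mult_strict_left_mono) auto
    finally show ?thesis
      using \<open>g 0 = 0\<close> by simp
  qed
  have "\<exists>q. q holomorphic_on unit_disc \<and> q 0 = 0 \<and>
      (\<forall>z\<in>unit_disc. norm (q z) < 1 \<and> p z = exp (q z))"
  proof (cases n)
    case 0
    have p: "p z = 1 + g z" if "z \<in> unit_disc" for z
    proof -
      have "p z - g z = p 0 - g 0"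
        using that 0 by (intro DERIV_zero_unit_disc) (auto intro!: derivative_eq_intros p' g')
      then show ?thesis
        using \<open>p 0 = 1\<close> \<open>g 0 = 0\<close> by (simp add: algebra_simps)
    qed
    have small: "norm (g z) < 1 - exp (- 1)" if "z \<in> unit_disc" for z
    proof -
      \<comment> \<open>From \<open>2 \<le> exp 1\<close>; it gives
        \<open>exp (- 1) \<le> 1 - exp (- 1)\<close>, the radius for \<open>t = 1\<close>.\<close>
      have "exp (- 1) \<le> (1 / 2 :: real)"
        using exp_ge_add_one_self[of 1] by (simp add: exp_minus field_simps)
      then show ?thesis
        using g_less[OF that] 0 by simp
    qed
    have g1: "norm (g z) < 1" if "z \<in> unit_disc" for z
      using small[OF that] exp_gt_zero[of "- 1 :: real"] by linarith
    have "(\<lambda>z. Ln (1 + g z)) holomorphic_on unit_disc"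
      using g1 by (intro holomorphic_intros holg one_plus_notin_nonpos_Reals)
    moreover have "p z = exp (Ln (1 + g z))" if "z \<in> unit_disc" for z
      using one_plus_notin_nonpos_Reals[OF g1[OF that]] p[OF that] by (subst exp_Ln) auto
    ultimately show ?thesis
      using norm_Ln_one_plus_less[OF small] \<open>g 0 = 0\<close>
      by (intro exI[of _ "\<lambda>z. Ln (1 + g z)"]) auto
  next
    case (Suc m)
    \<comment> \<open>This function plays the role of \<open>p' / p\<close>, but is holomorphic
      without knowing that \<open>p\<close> has no zeros; its primitive \<open>q\<close> is then a
      logarithm of \<open>p\<close>.\<close>
    have "(\<lambda>z. h z * p z ^ m) holomorphic_on unit_disc"
      by (intro holomorphic_intros holh holp)
    then obtain q where "q 0 = 0"
      and q': "\<And>z. z \<in> unit_disc \<Longrightarrow> (q has_field_derivative h z * p z ^ m) (at z)"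
      using holomorphic_primitive_unit_disc by blast
    have holq: "q holomorphic_on unit_disc"
      by (rule DERIV_imp_holomorphic_on) (rule q')
    have pq: "p z = exp (q z)" if "z \<in> unit_disc" for z
    proof -
      \<comment> \<open>Since \<open>p' = q' * p\<close>, the product \<open>p * exp (- q)\<close>
        has derivative 0.\<close>
      have "p z * exp (- q z) = p 0 * exp (- q 0)"
        using that Suc
        by (intro DERIV_zero_unit_disc)
           (auto intro!: derivative_eq_intros p' q' simp: algebra_simps)
      then show ?thesis
        using \<open>p 0 = 1\<close> \<open>q 0 = 0\<close> by (simp add: exp_minus field_simps)
    qed
    have "norm (q z) < 1" if z: "z \<in> unit_disc" for z
    proof (cases "m = 0")
      case True
      have "q z - g z = q 0 - g 0"
        using z True by (intro DERIV_zero_unit_disc) (auto intro!: derivative_eq_intros q' g')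
      then show ?thesis
        using g_less[OF z] True Suc \<open>q 0 = 0\<close> \<open>g 0 = 0\<close> by simp
    next
      case False
      \<comment> \<open>Chosen so that \<open>1 + u\<close> is \<open>p\<close> to the power
        \<open>- m\<close>, whose derivative is \<open>- m * h\<close> by the differential
        equation.\<close>
      define u where "u z = - of_nat m * g z" for z
      have small: "norm (u x) < 1 - exp (- real m)" if "x \<in> unit_disc" for x
      proof -
        have "norm (u x) < real m * exp (- real m)"
          using g_less[OF that] False Suc by (simp add: u_def norm_mult)
        \<comment> \<open>This is \<open>1 + m \<le> exp m\<close> multiplied by
          \<open>exp (- m)\<close>.\<close>
        also have "\<dots> \<le> 1 - exp (- real m)"
          using exp_ge_add_one_self[of "real m"] by (simp add: exp_minus field_simps)
        finally show ?thesis .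
      qed
      have u1: "norm (u x) < 1" if "x \<in> unit_disc" for x
        using small[OF that] exp_gt_zero[of "- real m"] by linarith
      have u': "(u has_field_derivative - of_nat m * h x) (at x)" if "x \<in> unit_disc" for x
        unfolding u_def using that by (auto intro!: derivative_eq_intros g')
      have pow: "p x ^ m * exp (- of_nat m * q x) = 1" if "x \<in> unit_disc" for x
        using pq[OF that] by (simp add: exp_of_nat_mult[symmetric] exp_minus)
      have exp_u: "exp (- of_nat m * q x) = 1 + u x" if "x \<in> unit_disc" for x
      proof -
        have "exp (- of_nat m * q x) - u x = exp (- of_nat m * q 0) - u 0"
        proof (rule DERIV_zero_unit_disc[OF _ that])
          fix y :: complex assume y: "y \<in> unit_disc"
          show "((\<lambda>z. exp (- of_nat m * q z) - u z) has_field_derivative 0) (at y)"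
            using pow[OF y]
            by (auto intro!: derivative_eq_intros q'[OF y] u'[OF y] simp: algebra_simps)
        qed
        then show ?thesis
          using \<open>q 0 = 0\<close> \<open>g 0 = 0\<close> by (simp add: u_def algebra_simps)
      qed
      \<comment> \<open>Applying \<open>Ln\<close> to \<open>exp_u\<close> would fix
        \<open>- m * q\<close> only up to a multiple of \<open>2 * pi * \<i>\<close>. Instead the
        derivatives of both logarithms are compared, and their values at 0 agree.\<close>
      have "Ln (1 + u z) + of_nat m * q z = Ln (1 + u 0) + of_nat m * q 0"
      proof (rule DERIV_zero_unit_disc[OF _ z])
        fix y :: complex assume y: "y \<in> unit_disc"
        have "p y ^ m * (1 + u y) = 1"
          using pow[OF y] exp_u[OF y] by simp
        then have eq: "p y ^ m = inverse (1 + u y)"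
          by (metis inverse_unique mult.commute)
        show "((\<lambda>z. Ln (1 + u z) + of_nat m * q z) has_field_derivative 0) (at y)"
          using one_plus_notin_nonpos_Reals[OF u1[OF y]] eq
          by (auto intro!: derivative_eq_intros q'[OF y] u'[OF y] simp: field_simps)
      qed
      then have "of_nat m * q z = - Ln (1 + u z)"
        using \<open>q 0 = 0\<close> \<open>g 0 = 0\<close> by (simp add: u_def algebra_simps add_eq_0_iff)
      then have "norm (of_nat m * q z) = norm (Ln (1 + u z))"
        by simp
      then have "real m * norm (q z) < real m * 1"
        using norm_Ln_one_plus_less[OF small[OF z]] by (simp add: norm_mult)
      then show ?thesis
        using False by simp
    qed
    then show ?thesis
      using holq \<open>q 0 = 0\<close> pq by blast
  qed
  then show ?thesis
    using holp by (auto simp: subordinate_def intro!: holomorphic_intros)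
qed

theorem theorem3p1:
  fixes n :: nat and \<alpha> \<beta> :: real and p :: "complex \<Rightarrow> complex"
  assumes "0 \<le> \<alpha>" and "\<alpha> < 1"
    and "n = 0 \<Longrightarrow> \<beta> \<ge> exp 1 * (1 - \<alpha>)"
    and "n \<noteq> 0 \<Longrightarrow> \<beta> \<ge> exp 1 ^ (n - 1) * (1 - \<alpha>)"
    and "p \<in> class_H1"
    and "(\<lambda>z. 1 + of_real \<beta> * (z * deriv p z / p z ^ n)) \<prec>\<^sub>D (\<lambda>z. 1 + of_real (1 - \<alpha>) * z)"
  shows "p \<prec>\<^sub>D exp"
proof -
  \<comment> \<open>Both cases of the hypothesis on \<open>\<beta>\<close> become
    \<open>E * (1 - \<alpha>) \<le> \<beta>\<close>, and \<open>inverse E\<close> is the bound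
    required of \<open>c\<close>.\<close>
  define E :: real where "E = (if n = 0 then exp 1 else exp (real (n - 1)))"
  have "E > 0"
    by (simp add: E_def)
  have E_le: "E * (1 - \<alpha>) \<le> \<beta>"
    using assms(3,4) exp_of_nat_mult[of "n - 1" "1 :: real"] by (auto simp: E_def)
  then have "\<beta> > 0"
    using mult_pos_pos[OF \<open>E > 0\<close>, of "1 - \<alpha>"] assms(2) by linarith
  have holp: "p holomorphic_on unit_disc"
    using assms(5) by (simp add: class_H1_def)
  obtain a where "a 0 = 1" and a: "\<forall>z\<in>unit_disc. (\<lambda>k. a k * z ^ k) sums p z"
    using assms(5) unfolding class_H1_def by blast
  \<comment> \<open>At 0 the series reduces to \<open>a 0\<close>, since
    \<open>0 ^ 0 = 1\<close>.\<close>
  moreover have "(\<lambda>k. a k * 0 ^ k) sums p 0"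
    by (rule bspec[OF a]) simp
  ultimately have "p 0 = 1"
    using sums_unique2[OF powser_sums_zero[of a]] by metis
  have "(1 - \<alpha>) / \<beta> \<le> inverse E"
    using E_le \<open>E > 0\<close> \<open>\<beta> > 0\<close> by (simp add: field_simps)
  then have "(1 - \<alpha>) / \<beta> \<le> (if n = 0 then exp (- 1) else exp (- real (n - 1)))"
    by (simp only: E_def exp_minus if_distrib[of inverse])
  moreover obtain h where "h holomorphic_on unit_disc"
    "\<And>z. z \<in> unit_disc \<Longrightarrow> norm (h z) \<le> (1 - \<alpha>) / \<beta>"
    "\<And>z. z \<in> unit_disc \<Longrightarrow> (p has_field_derivative h z * p z ^ n) (at z)"
    using subordinate_imp_ode[OF assms(2) \<open>\<beta> > 0\<close> holp \<open>p 0 = 1\<close> assms(6)] by blast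
  ultimately show ?thesis
    using \<open>p 0 = 1\<close> by (intro ode_imp_subordinate_exp[of p h n "(1 - \<alpha>) / \<beta>"])
qed

end
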